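(* Let $Q=(q_{ij})$ be a real symmetric $n\times n$ matrix with zero diagonal, $c\in\mathbb{R}^n$, $R_i=\{j:q_{ij}\neq0\}$, $R^+_i=\{j:q_{ij}>0\}$, $R^-_i=\{j:q_{ij}<0\}$, and let $\gamma_{ij}>0,\delta_{ij}>0$ for $j\in R^+_i$, $i=1,\dots,n$. Consider the MILP ORGW($*,\gamma+\delta$) in variables $x_i$ and $y_{ij}$ ($j\in R_i$): maximize $\sum_{i=1}^n\sum_{j\in R_i}q_{ij}y_{ij}+\sum_{i=1}^n c_ix_i$ subject to $x_i+x_j-y_{ij}\le 1$ for all $j\in R^-_i$, $i=1,\dots,n$; $\sum_{j\in R^+_i}\gamma_{ij}y_{ij}+\sum_{j\in R^+_i}\delta_{ij}y_{ji}\le\left(\sum_{j\in R^+_i}\gamma_{ij}+\sum_{j\in R^+_i}\delta_{ij}\right)x_i$ for $i=1,\dots,n$; $x_i\in\{0,1\}$ for all $i$; $0\le y_{ij}\le 1$ for all $j\in R_i$, $i=1,\dots,n$. Then ORGW($*,\gamma+\delta$) is a valid (optimality restricted) formulation of QUBO.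
   Context: QUBO is the problem: maximize $\sum_{i=1}^n\sum_{j\in R_i}q_{ij}x_ix_j+\sum_{i=1}^n c_ix_i$ over $x\in\{0,1\}^n$. An MILP in variables $(x,y)$ with objective $\sum_i\sum_{j\in R_i}q_{ij}y_{ij}+\sum_i c_ix_i$ is a valid (optimality restricted) formulation of QUBO if its optimal objective value equals the optimal value of QUBO and the $x$-part of every optimal solution of the MILP is an optimal solution of QUBO (the variables $y_{ij}$ need only equal $x_ix_j$ at optimal solutions). *)

theory Defs
  imports "HOL-Analysis.Analysis" "HOL-Library.FuncSet"
begin

definition supp :: "real^'n^'n \<Rightarrow> 'n \<Rightarrow> 'n set" where
  "supp Q i = {j. Q $ i $ j \<noteq> 0}"

definition supp_pos :: "real^'n^'n \<Rightarrow> 'n \<Rightarrow> 'n set" where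
  "supp_pos Q i = {j. Q $ i $ j > 0}"

definition supp_neg :: "real^'n^'n \<Rightarrow> 'n \<Rightarrow> 'n set" where
  "supp_neg Q i = {j. Q $ i $ j < 0}"

definition binary_vectors :: "(real^'n) set" where
  "binary_vectors = {x. \<forall>i. x $ i \<in> {0, 1}}"

definition qubo_obj :: "real^'n^'n \<Rightarrow> real^'n \<Rightarrow> real^'n \<Rightarrow> real" where
  "qubo_obj Q c x =
     (\<Sum>i\<in>UNIV. \<Sum>j\<in>supp Q i. Q $ i $ j * x $ i * x $ j) + (\<Sum>i\<in>UNIV. c $ i * x $ i)"

text \<open>
  The variable \<open>y\<^sub>i\<^sub>j\<close> is \<open>y (i, j)\<close>. It belongs to the ordered pair, so \<open>y (i, j)\<close> and
  \<open>y (j, i)\<close> are different variables, and it is only present for \<open>j \<in> supp Q i\<close>.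
\<close>

definition milp_obj :: "real^'n^'n \<Rightarrow> real^'n \<Rightarrow> (real^'n) \<times> ('n \<times> 'n \<Rightarrow> real) \<Rightarrow> real" where
  "milp_obj Q c = (\<lambda>(x, y).
     (\<Sum>i\<in>UNIV. \<Sum>j\<in>supp Q i. Q $ i $ j * y (i, j)) + (\<Sum>i\<in>UNIV. c $ i * x $ i))"

definition optimal_solution :: "('a \<Rightarrow> real) \<Rightarrow> 'a set \<Rightarrow> 'a \<Rightarrow> bool" where
  "optimal_solution f S z \<longleftrightarrow> is_arg_max f (\<lambda>w. w \<in> S) z"

text \<open>
  The optimal value is a relation, not a supremum: it holds of no number if the maximum is not
  attained.
\<close>

definition optimal_value :: "('a \<Rightarrow> real) \<Rightarrow> 'a set \<Rightarrow> real \<Rightarrow> bool" where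
  "optimal_value f S v \<longleftrightarrow> (\<exists>z. optimal_solution f S z \<and> f z = v)"

text \<open>
  Here \<open>F\<close> is the feasible set of a program in the variables \<open>(x, y)\<close> with objective
  \<^term>\<open>milp_obj Q c\<close>.
\<close>

definition valid_formulation ::
  "real^'n^'n \<Rightarrow> real^'n \<Rightarrow> ((real^'n) \<times> ('n \<times> 'n \<Rightarrow> real)) set \<Rightarrow> bool" where
  "valid_formulation Q c F \<longleftrightarrow>
     (\<exists>v. optimal_value (milp_obj Q c) F v \<and> optimal_value (qubo_obj Q c) binary_vectors v) \<and>
     (\<forall>x y. optimal_solution (milp_obj Q c) F (x, y) \<longrightarrow>
        optimal_solution (qubo_obj Q c) binary_vectors x)"

definition optimality_restricted ::
  "real^'n^'n \<Rightarrow> real^'n \<Rightarrow> ((real^'n) \<times> ('n \<times> 'n \<Rightarrow> real)) set \<Rightarrow> bool" where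
  "optimality_restricted Q c F \<longleftrightarrow>
     (\<forall>x y. optimal_solution (milp_obj Q c) F (x, y) \<longrightarrow>
        (\<forall>i. \<forall>j\<in>supp Q i. y (i, j) = x $ i * x $ j))"

text \<open>
  Membership in the extensional function space gives the bounds \<open>0 \<le> y\<^sub>i\<^sub>j \<le> 1\<close> for
  \<open>j \<in> supp Q i\<close> and fixes \<open>y\<close> at all other pairs, which are not variables of the program.
  The term \<open>y (j, i)\<close> is a variable because \<open>Q\<close> is symmetric.
\<close>

definition ORGW ::
  "real^'n^'n \<Rightarrow> ('n \<Rightarrow> 'n \<Rightarrow> real) \<Rightarrow> ('n \<Rightarrow> 'n \<Rightarrow> real) \<Rightarrow>
     ((real^'n) \<times> ('n \<times> 'n \<Rightarrow> real)) set" where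
  "ORGW Q \<gamma> \<delta> = {(x, y).
     (\<forall>i. \<forall>j\<in>supp_neg Q i. x $ i + x $ j - y (i, j) \<le> 1) \<and>
     (\<forall>i. (\<Sum>j\<in>supp_pos Q i. \<gamma> i j * y (i, j)) + (\<Sum>j\<in>supp_pos Q i. \<delta> i j * y (j, i))
          \<le> ((\<Sum>j\<in>supp_pos Q i. \<gamma> i j) + (\<Sum>j\<in>supp_pos Q i. \<delta> i j)) * x $ i) \<and>
     x \<in> binary_vectors \<and>
     y \<in> (SIGMA i:UNIV. supp Q i) \<rightarrow>\<^sub>E {0..1}}"

end

theory Submission
  imports Defs
begin

text \<open>
  If \<open>x\<^sub>i = 0\<close>, the knapsack constraint of row \<open>i\<close>, all of whose terms are nonnegative, forces
  \<open>y\<^sub>i\<^sub>j = y\<^sub>j\<^sub>i = 0\<close> for all \<open>j \<in> R\<^sub>i\<^sup>+\<close>; with the constraint of row \<open>j\<close> this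
  yields \<open>y\<^sub>i\<^sub>j \<le> x\<^sub>i x\<^sub>j\<close> whenever \<open>q\<^sub>i\<^sub>j > 0\<close>. If \<open>q\<^sub>i\<^sub>j < 0\<close>, the first
  constraint family yields \<open>y\<^sub>i\<^sub>j \<ge> x\<^sub>i x\<^sub>j\<close>. So every term \<open>q\<^sub>i\<^sub>j y\<^sub>i\<^sub>j\<close> of the objective
  is at most \<open>q\<^sub>i\<^sub>j x\<^sub>i x\<^sub>j\<close>, and since the products \<open>x\<^sub>i x\<^sub>j\<close> are themselves feasible, an
  optimal solution attains equality in every term.
\<close>

text \<open>\<open>restrict\<close> makes the function \<open>undefined\<close> at pairs outside the
  support, as membership in the extensional function space of \<open>ORGW\<close> requires.\<close>

definition product_lift :: "real^'n^'n \<Rightarrow> real^'n \<Rightarrow> 'n \<times> 'n \<Rightarrow> real" where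
  "product_lift Q x = restrict (\<lambda>(i, j). x $ i * x $ j) (SIGMA i:UNIV. supp Q i)"

lemma product_lift_apply: "j \<in> supp Q i \<Longrightarrow> product_lift Q x (i, j) = x $ i * x $ j"
  by (simp add: product_lift_def)

lemma milp_obj_product_lift: "milp_obj Q c (x, product_lift Q x) = qubo_obj Q c x"
  by (simp add: milp_obj_def qubo_obj_def product_lift_apply mult.assoc)

lemma supp_pos_subset_supp: "supp_pos Q i \<subseteq> supp Q i"
  by (auto simp: supp_pos_def supp_def)

lemma transpose_eq_imp_nth_sym:
  assumes "transpose Q = Q"
  shows "Q $ j $ i = Q $ i $ j"
proof -
  have "transpose Q $ i $ j = Q $ j $ i"
    by (simp add: transpose_def)
  with assms show ?thesis
    by simp
qed

lemma supp_sym: "transpose Q = Q \<Longrightarrow> j \<in> supp Q i \<longleftrightarrow> i \<in> supp Q j"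
  by (simp add: supp_def transpose_eq_imp_nth_sym)

lemma supp_pos_sym: "transpose Q = Q \<Longrightarrow> j \<in> supp_pos Q i \<longleftrightarrow> i \<in> supp_pos Q j"
  by (simp add: supp_pos_def transpose_eq_imp_nth_sym)

lemma binary_vectors_cases:
  assumes "x \<in> binary_vectors"
  obtains "x $ i = 0" | "x $ i = 1"
  using assms by (auto simp: binary_vectors_def)

lemma finite_binary_vectors: "finite (binary_vectors :: (real^'n) set)"
proof (rule finite_subset)
  show "(binary_vectors :: (real^'n) set) \<subseteq> vec_lambda ` (UNIV \<rightarrow>\<^sub>E {0, 1})"
  proof
    fix x :: "real^'n"
    assume "x \<in> binary_vectors"
    then have "vec_nth x \<in> UNIV \<rightarrow>\<^sub>E {0, 1}"
      by (auto simp: binary_vectors_def)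
    then show "x \<in> vec_lambda ` (UNIV \<rightarrow>\<^sub>E {0, 1})"
      by (metis imageI vec_nth_inverse)
  qed
  show "finite (vec_lambda ` (UNIV \<rightarrow>\<^sub>E {0, 1}) :: (real^'n) set)"
    by (intro finite_imageI finite_PiE) auto
qed

lemma optimal_solution_iff:
  "optimal_solution f S z \<longleftrightarrow> z \<in> S \<and> (\<forall>w\<in>S. f w \<le> f z)"
  by (auto simp: optimal_solution_def is_arg_max_linorder)

text \<open>A finite nonempty set of values has a maximum. Since \<open>optimal_value\<close> asks
  for attainment, this supplies the witness from which both optimal values are obtained.\<close>

lemma qubo_optimal_solution_exists: "\<exists>x. optimal_solution (qubo_obj Q c) binary_vectors x"
proof -
  have "(0 :: real^'n) \<in> binary_vectors"
    by (simp add: binary_vectors_def)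
  then have ne: "(binary_vectors :: (real^'n) set) \<noteq> {}"
    by blast
  define m where "m = Max (qubo_obj Q c ` binary_vectors)"
  have "m \<in> qubo_obj Q c ` binary_vectors"
    unfolding m_def using ne finite_binary_vectors by (intro Max_in) auto
  moreover have "qubo_obj Q c w \<le> m" if "w \<in> binary_vectors" for w
    unfolding m_def using that finite_binary_vectors by (intro Max_ge) auto
  ultimately show ?thesis
    by (auto simp: optimal_solution_iff)
qed

lemma product_lift_in_ORGW:
  fixes Q :: "real^'n^'n"
  assumes sym: "transpose Q = Q"
    and \<gamma>: "\<And>i j. j \<in> supp_pos Q i \<Longrightarrow> \<gamma> i j \<ge> 0"
    and \<delta>: "\<And>i j. j \<in> supp_pos Q i \<Longrightarrow> \<delta> i j \<ge> 0"
    and x: "x \<in> binary_vectors"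
  shows "(x, product_lift Q x) \<in> ORGW Q \<gamma> \<delta>"
proof -
  have bounds: "0 \<le> x $ i" "x $ i \<le> 1" for i
    using x by (auto elim: binary_vectors_cases[of x i])
  have "x $ i + x $ j - product_lift Q x (i, j) \<le> 1" if "j \<in> supp_neg Q i" for i j
  proof -
    have "j \<in> supp Q i"
      using that by (simp add: supp_neg_def supp_def)
    \<comment> \<open>Expanded, this inequality is the constraint for a negative entry with
      \<open>y (i, j)\<close> replaced by the product.\<close>
    moreover have "(1 - x $ i) * (1 - x $ j) \<ge> 0"
      using bounds by simp
    ultimately show ?thesis
      by (simp add: product_lift_apply algebra_simps)
  qed
  moreover have "(\<Sum>j\<in>supp_pos Q i. \<gamma> i j * product_lift Q x (i, j))
        + (\<Sum>j\<in>supp_pos Q i. \<delta> i j * product_lift Q x (j, i))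
      \<le> ((\<Sum>j\<in>supp_pos Q i. \<gamma> i j) + (\<Sum>j\<in>supp_pos Q i. \<delta> i j)) * x $ i" for i
  proof -
    have le: "x $ i * x $ j \<le> x $ i" for j
      using bounds by (simp add: mult_left_le)
    have lift: "product_lift Q x (i, j) = x $ i * x $ j"
        "product_lift Q x (j, i) = x $ i * x $ j" if "j \<in> supp_pos Q i" for j
      using that supp_pos_subset_supp[of Q i] supp_sym[OF sym, of i j]
      by (auto simp: product_lift_apply)
    show ?thesis
      \<comment> \<open>Once \<open>x $ i\<close> is moved into the sums on the right, both sides
        compare term by term through \<open>le\<close>.\<close>
      unfolding distrib_right sum_distrib_right
      by (intro add_mono sum_mono) (simp_all add: lift le \<gamma> \<delta> mult_left_mono)
  qed
  moreover have "product_lift Q x \<in> (SIGMA i:UNIV. supp Q i) \<rightarrow>\<^sub>E {0..1}"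
    using bounds by (auto simp: product_lift_def intro!: mult_le_one)
  ultimately show ?thesis
    using x by (simp add: ORGW_def)
qed

lemma ORGW_row_zero:
  fixes Q :: "real^'n^'n"
  assumes sym: "transpose Q = Q"
    and \<gamma>: "\<And>i j. j \<in> supp_pos Q i \<Longrightarrow> \<gamma> i j > 0"
    and \<delta>: "\<And>i j. j \<in> supp_pos Q i \<Longrightarrow> \<delta> i j > 0"
    and xy: "(x, y) \<in> ORGW Q \<gamma> \<delta>"
    and xi: "x $ i = 0" and j: "j \<in> supp_pos Q i"
  shows "y (i, j) = 0" and "y (j, i) = 0"
proof -
  \<comment> \<open>Symmetry puts \<open>(k, i)\<close> into the index set as well, so the bounds of
    \<open>ORGW\<close> apply to \<open>y (k, i)\<close>.\<close>
  have nonneg: "0 \<le> y (i, k)" "0 \<le> y (k, i)" if "k \<in> supp_pos Q i" for k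
    using xy that supp_pos_subset_supp[of Q i] supp_sym[OF sym, of i k]
    by (fastforce simp: ORGW_def PiE_iff)+
  have A: "0 \<le> \<gamma> i k * y (i, k)" and B: "0 \<le> \<delta> i k * y (k, i)" if "k \<in> supp_pos Q i" for k
    using that nonneg \<gamma> \<delta> by (simp_all add: less_imp_le)
  have "(\<Sum>k\<in>supp_pos Q i. \<gamma> i k * y (i, k)) + (\<Sum>k\<in>supp_pos Q i. \<delta> i k * y (k, i)) \<le> 0"
    using xy xi unfolding ORGW_def by (auto dest: spec[of _ i])
  moreover have "0 \<le> (\<Sum>k\<in>supp_pos Q i. \<gamma> i k * y (i, k))"
    and "0 \<le> (\<Sum>k\<in>supp_pos Q i. \<delta> i k * y (k, i))"
    by (simp_all add: sum_nonneg A B)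
  ultimately have "(\<Sum>k\<in>supp_pos Q i. \<gamma> i k * y (i, k)) = 0"
    and "(\<Sum>k\<in>supp_pos Q i. \<delta> i k * y (k, i)) = 0"
    by linarith+
  then have "\<gamma> i j * y (i, j) = 0" and "\<delta> i j * y (j, i) = 0"
    using j A B by (simp_all add: sum_nonneg_eq_0_iff)
  then show "y (i, j) = 0" and "y (j, i) = 0"
    using \<gamma>[OF j] \<delta>[OF j] by simp_all
qed

lemma ORGW_term_le:
  fixes Q :: "real^'n^'n"
  assumes sym: "transpose Q = Q"
    and \<gamma>: "\<And>i j. j \<in> supp_pos Q i \<Longrightarrow> \<gamma> i j > 0"
    and \<delta>: "\<And>i j. j \<in> supp_pos Q i \<Longrightarrow> \<delta> i j > 0"
    and xy: "(x, y) \<in> ORGW Q \<gamma> \<delta>"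
    and j: "j \<in> supp Q i"
  shows "Q $ i $ j * y (i, j) \<le> Q $ i $ j * (x $ i * x $ j)"
proof -
  have x: "x \<in> binary_vectors"
    using xy by (simp add: ORGW_def)
  have y: "0 \<le> y (i, j)" "y (i, j) \<le> 1"
    using xy j by (fastforce simp: ORGW_def PiE_iff)+
  show ?thesis
  proof (cases "Q $ i $ j > 0")
    case True
    then have ij: "j \<in> supp_pos Q i" and ji: "i \<in> supp_pos Q j"
      using supp_pos_sym[OF sym] by (auto simp: supp_pos_def)
    have zero: "y (k, l) = 0" "y (l, k) = 0" if "x $ k = 0" "l \<in> supp_pos Q k" for k l
      using ORGW_row_zero[OF sym _ _ xy that] \<gamma> \<delta> by blast+
    \<comment> \<open>If \<open>x $ i = 0\<close>, row \<open>i\<close> kills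
      \<open>y (i, j)\<close> as a \<gamma>-term; if \<open>x $ j = 0\<close>, row \<open>j\<close>
      kills it as a \<delta>-term. Otherwise the product is 1, the upper bound of
      \<open>y (i, j)\<close>.\<close>
    have "y (i, j) \<le> x $ i * x $ j"
      using zero(1)[OF _ ij] zero(2)[OF _ ji] y
      by (rule_tac binary_vectors_cases[OF x, of i];
          rule_tac binary_vectors_cases[OF x, of j]) simp_all
    with True show ?thesis
      by simp
  next
    case False
    with j have neg: "Q $ i $ j < 0"
      by (simp add: supp_def)
    then have "x $ i + x $ j - y (i, j) \<le> 1"
      using xy by (simp add: ORGW_def supp_neg_def)
    \<comment> \<open>If both entries are 1, the constraint forces \<open>y (i, j)\<close> up to 1;
      otherwise the product is 0.\<close>
    then have "x $ i * x $ j \<le> y (i, j)"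
      using y by (rule_tac binary_vectors_cases[OF x, of i];
          rule_tac binary_vectors_cases[OF x, of j]) simp_all
    with neg show ?thesis
      by simp
  qed
qed

theorem theorem16:
  fixes Q :: "real^'n^'n" and c :: "real^'n" and \<gamma> \<delta> :: "'n \<Rightarrow> 'n \<Rightarrow> real"
  assumes "transpose Q = Q"
    and "\<And>i. Q $ i $ i = 0"
    and "\<And>i j. j \<in> supp_pos Q i \<Longrightarrow> \<gamma> i j > 0"
    and "\<And>i j. j \<in> supp_pos Q i \<Longrightarrow> \<delta> i j > 0"
  shows "valid_formulation Q c (ORGW Q \<gamma> \<delta>) \<and> optimality_restricted Q c (ORGW Q \<gamma> \<delta>)"
proof -
  let ?F = "ORGW Q \<gamma> \<delta>"
  have term_le: "Q $ i $ j * y (i, j) \<le> Q $ i $ j * (x $ i * x $ j)"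
    if "(x, y) \<in> ?F" "j \<in> supp Q i" for x y i j
    using ORGW_term_le[OF assms(1) _ _ that] assms(3,4) by blast
  have lift: "(x, product_lift Q x) \<in> ?F" if "x \<in> binary_vectors" for x
    using product_lift_in_ORGW[OF assms(1) _ _ that] assms(3,4) by (meson less_imp_le)
  have binary: "x \<in> binary_vectors" if "(x, y) \<in> ?F" for x y
    using that by (simp add: ORGW_def)
  have le: "milp_obj Q c (x, y) \<le> qubo_obj Q c x" if "(x, y) \<in> ?F" for x y
    using term_le[OF that]
    by (auto simp: milp_obj_def qubo_obj_def mult.assoc intro!: sum_mono)
  obtain x0 where x0: "optimal_solution (qubo_obj Q c) binary_vectors x0"
    using qubo_optimal_solution_exists by blast
  have "optimal_solution (milp_obj Q c) ?F (x0, product_lift Q x0)"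
    unfolding optimal_solution_iff
  proof (intro conjI ballI)
    show "(x0, product_lift Q x0) \<in> ?F"
      using x0 lift by (simp add: optimal_solution_iff)
    fix z
    assume z: "z \<in> ?F"
    obtain x y where [simp]: "z = (x, y)"
      by fastforce
    have "milp_obj Q c (x, y) \<le> qubo_obj Q c x"
      using z le by simp
    also have "\<dots> \<le> qubo_obj Q c x0"
      using x0 z binary by (simp add: optimal_solution_iff)
    finally show "milp_obj Q c z \<le> milp_obj Q c (x0, product_lift Q x0)"
      by (simp add: milp_obj_product_lift)
  qed
  then have opt_values: "optimal_value (milp_obj Q c) ?F (qubo_obj Q c x0)"
    "optimal_value (qubo_obj Q c) binary_vectors (qubo_obj Q c x0)"
    using x0 milp_obj_product_lift unfolding optimal_value_def by blast+
  \<comment> \<open>The optimal point competes with the lift of \<open>w\<close>, whose objective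
    value is \<open>qubo_obj Q c w\<close>.\<close>
  have dominates: "qubo_obj Q c w \<le> milp_obj Q c (x, y)"
    if "optimal_solution (milp_obj Q c) ?F (x, y)" "w \<in> binary_vectors" for x y w
    using that lift[OF that(2)] milp_obj_product_lift[of Q c w]
    by (metis optimal_solution_iff)
  \<comment> \<open>For binary \<open>w\<close>, \<open>dominates\<close> and \<open>le\<close>
    chain to \<open>qubo_obj Q c w\<close> \<le> \<open>milp_obj Q c (x, y)\<close> \<le>
    \<open>qubo_obj Q c x\<close>.\<close>
  have "optimal_solution (qubo_obj Q c) binary_vectors x"
    if opt: "optimal_solution (milp_obj Q c) ?F (x, y)" for x y
    using dominates[OF opt] opt le binary by (fastforce simp: optimal_solution_iff)
  moreover have "y (i, j) = x $ i * x $ j"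
    if opt: "optimal_solution (milp_obj Q c) ?F (x, y)" and j: "j \<in> supp Q i" for x y i j
  proof -
    have xy: "(x, y) \<in> ?F"
      using opt by (simp add: optimal_solution_iff)
    \<comment> \<open>The gaps are nonnegative on the support and their total is 0, by
      \<open>dominates\<close> at \<open>w = x\<close> together with \<open>le\<close>. So each gap
      vanishes, and the nonzero factor \<open>Q $ i $ j\<close> cancels.\<close>
    let ?gap = "\<lambda>i j. Q $ i $ j * (x $ i * x $ j) - Q $ i $ j * y (i, j)"
    have gap: "0 \<le> ?gap k l" if "l \<in> supp Q k" for k l
      using term_le[OF xy that] by simp
    have "(\<Sum>k\<in>UNIV. \<Sum>l\<in>supp Q k. ?gap k l) = qubo_obj Q c x - milp_obj Q c (x, y)"
      by (simp add: qubo_obj_def milp_obj_def sum_subtractf mult.assoc)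
    also have "\<dots> = 0"
      using dominates[OF opt binary[OF xy]] le[OF xy] by simp
    finally have "(\<Sum>l\<in>supp Q i. ?gap i l) = 0"
      using gap by (subst (asm) sum_nonneg_eq_0_iff) (auto intro!: sum_nonneg)
    then have "?gap i j = 0"
      using gap j by (subst (asm) sum_nonneg_eq_0_iff) auto
    with j show ?thesis
      by (simp add: supp_def)
  qed
  ultimately show ?thesis
    using opt_values unfolding valid_formulation_def optimality_restricted_def by blast
qed

end
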